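(* For every integer $n\geqslant 3$, the number of partitions of $n$ with no parts equal to $1$ and with the largest part occurring more than once equals $\nabla^2[p](n)=p(n)-2p(n-1)+p(n-2)$, and $$\nabla^2 [p](n) = -\sum_{k=4}^{n+5} S^{(4)}_{n+5,k}\, \mu(k).$$
   Context: $p(m)$ denotes the number of partitions of the non-negative integer $m$ (with $p(0)=1$). The $N$th order backward difference of a function $f$ is $\nabla^N[f](x)=\sum_{k=0}^N(-1)^k\binom{N}{k}f(x-k)$. $\mu$ is the classical Möbius function on positive integers: $\mu(m)=0$ if $m$ is divisible by the square of a prime, and $\mu(m)=(-1)^s$ if $m$ is a product of $s\geqslant 0$ distinct primes. For integers $r\geqslant 1$, $k\geqslant 1$, $m\geqslant 0$, $S^{(r)}_{m,k}$ denotes the number of $k$'s in the partitions of $m$ with smallest part at least $r$, i.e. the total number of occurrences (with multiplicity) of the part $k$ summed over all partitions of $m$ all of whose parts are $\geqslant r$. *)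

theory Defs
  imports "HOL-Library.Multiset" "HOL-Computational_Algebra.Primes"
begin

definition partitions :: "nat \<Rightarrow> nat multiset set" where
  "partitions m = {M. 0 \<notin># M \<and> sum_mset M = m}"

definition num_partitions :: "nat \<Rightarrow> nat" where
  "num_partitions m = card (partitions m)"

text \<open>The argument of \<open>f\<close> is a natural number, so the truncated subtraction \<open>x - k\<close> is
  the intended one exactly when \<open>N \<le> x\<close>.\<close>

definition backward_diff :: "nat \<Rightarrow> (nat \<Rightarrow> int) \<Rightarrow> nat \<Rightarrow> int" where
  "backward_diff N f x = (\<Sum>k\<le>N. (-1) ^ k * int (N choose k) * f (x - k))"

definition moebius :: "nat \<Rightarrow> int" where
  "moebius m = (if \<exists>q. prime q \<and> q\<^sup>2 dvd m then 0 else (-1) ^ card (prime_factors m))"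

definition part_occurrences :: "nat \<Rightarrow> nat \<Rightarrow> nat \<Rightarrow> nat" where
  "part_occurrences r m k = (\<Sum>M | M \<in> partitions m \<and> (\<forall>x\<in>#M. r \<le> x). count M k)"

text \<open>Finiteness guarantees that the cardinalities and sums over partitions above are not
  the default value that is used for infinite sets.\<close>

lemma finite_partitions: "finite (partitions m)"
proof (rule finite_subset)
  have size_le: "size M \<le> sum_mset M" if "0 \<notin># M" for M :: "nat multiset"
    using that by (induction M) auto
  show "partitions m \<subseteq> mset ` {xs. set xs \<subseteq> {..m} \<and> length xs \<le> m}"
  proof
    fix M assume M: "M \<in> partitions m"
    obtain xs where xs: "mset xs = M" using ex_mset by blast
    have "x \<le> m" if "x \<in># M" for x
      using that M by (auto simp: partitions_def dest!: multi_member_split)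
    moreover have "length xs \<le> m"
      using size_le[of M] M xs by (auto simp: partitions_def)
    ultimately show "M \<in> mset ` {xs. set xs \<subseteq> {..m} \<and> length xs \<le> m}"
      using xs by auto
  qed
  show "finite (mset ` {xs. set xs \<subseteq> {..m} \<and> length xs \<le> m})"
    by (intro finite_imageI finite_lists_length_le) simp
qed

end

theory Submission
  imports Defs "HOL-Computational_Algebra.Formal_Power_Series"
begin

unbundle fps_syntax

text \<open>
  Let \<open>P r\<close> be the generating function of the partitions with all parts at least \<open>r\<close>, so that
  \<open>P (r + 1) = (1 - X ^ r) * P r\<close>, and let \<open>D k = X ^ k / (1 - X ^ k)\<close>. For \<open>k \<ge> r\<close> the generating
  function of the occurrences of the part \<open>k\<close> is \<open>P r * D k\<close>. The coefficient of \<open>X ^ N\<close> in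
  \<open>\<Sum>k\<ge>1. \<mu>(k) * D k\<close> is \<open>\<Sum>k dvd N. \<mu>(k)\<close>, so this series equals \<open>X\<close>. Removing the terms
  \<open>k = 1, 2, 3\<close> leaves \<open>X - D 1 + D 2 + D 3\<close>, and multiplying this by
  \<open>P 4 = (1 - X) * (1 - X ^ 2) * (1 - X ^ 3) * P 1\<close> gives \<open>- X ^ 5 * (1 - X) ^ 2 * P 1\<close>.

  On the combinatorial side, \<open>p(n) - p(n - 1)\<close> counts the partitions of \<open>n\<close> without ones, and
  increasing a largest part by one maps the partitions of \<open>n - 1\<close> without ones bijectively to
  those of \<open>n\<close> whose largest part is unique.
\<close>

section \<open>Partitions with bounded smallest part\<close>

definition partitions_ge :: "nat \<Rightarrow> nat \<Rightarrow> nat multiset set" where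
  "partitions_ge r m = {M \<in> partitions m. \<forall>x\<in>#M. r \<le> x}"

lemma finite_partitions_ge [simp]: "finite (partitions_ge r m)"
  by (simp add: partitions_ge_def finite_partitions)

text \<open>For \<open>r \<ge> 1\<close> the bound on the parts already excludes zero, so that
  condition of \<open>partitions\<close> drops out.\<close>

lemma partitions_ge_iff:
  "r \<ge> 1 \<Longrightarrow> M \<in> partitions_ge r m \<longleftrightarrow> (\<forall>x\<in>#M. r \<le> x) \<and> sum_mset M = m"
  by (force simp: partitions_ge_def partitions_def)

lemma partitions_ge_1: "partitions_ge 1 m = partitions m"
  by (auto simp: partitions_ge_def partitions_def Suc_le_eq intro!: gr0I)

text \<open>Deleting one copy of \<open>k\<close> is the inverse map. Both recurrences below, for
  cardinalities and for occurrences, rest on this.\<close>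

lemma bij_betw_add_part:
  assumes "1 \<le> r" "r \<le> k"
  shows "bij_betw (add_mset k) (partitions_ge r m) {M \<in> partitions_ge r (k + m). k \<in># M}"
  using assms
  by (intro bij_betw_byWitness[where f' = "\<lambda>M. M - {#k#}"])
     (auto simp: partitions_ge_iff sum_mset_diff dest!: in_diffD)

lemma partitions_ge_without:
  assumes "1 \<le> r"
  shows "{M \<in> partitions_ge r m. r \<notin># M} = partitions_ge (Suc r) m"
proof -
  have "(\<forall>x\<in>#M. r \<le> x) \<and> r \<notin># M \<longleftrightarrow> (\<forall>x\<in>#M. Suc r \<le> x)" for M
    by (metis Suc_leD le_antisym not_less_eq_eq order_refl)
  then show ?thesis
    using assms by (intro set_eqI) (simp add: partitions_ge_iff, blast)
qed

lemma no_part_if_small: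
  assumes "M \<in> partitions_ge r m" "m < k"
  shows "k \<notin># M"
  using assms by (auto simp: partitions_ge_def partitions_def dest!: multi_member_split)

text \<open>Classify by whether \<open>r\<close> occurs, and delete one copy if it does. The case
  distinction keeps the truncated \<open>m - r\<close> from counting the empty partition when
  \<open>m < r\<close>.\<close>

lemma card_partitions_ge_split:
  assumes "1 \<le> r"
  shows "card (partitions_ge r m)
    = card (partitions_ge (Suc r) m) + (if r \<le> m then card (partitions_ge r (m - r)) else 0)"
proof -
  have "card (partitions_ge r m)
      = card {M \<in> partitions_ge r m. r \<notin># M} + card {M \<in> partitions_ge r m. r \<in># M}"
    by (subst card_Un_disjoint[symmetric]) (auto intro!: arg_cong[where f = card])
  moreover have "card {M \<in> partitions_ge r m. r \<in># M}
      = (if r \<le> m then card (partitions_ge r (m - r)) else 0)"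
  proof (cases "r \<le> m")
    case True
    then show ?thesis
      using bij_betw_same_card[OF bij_betw_add_part[of r r "m - r"]] assms by simp
  next
    case False
    then have "{M \<in> partitions_ge r m. r \<in># M} = {}"
      using no_part_if_small[of _ r m r] by auto
    then show ?thesis using False by simp
  qed
  ultimately show ?thesis
    by (simp add: partitions_ge_without[OF assms])
qed

section \<open>Counting the occurrences of a part\<close>

lemma part_occurrences_eq_sum:
  "part_occurrences r m k = (\<Sum>M\<in>partitions_ge r m. count M k)"
  by (simp add: part_occurrences_def partitions_ge_def)

text \<open>Only partitions containing \<open>k\<close> contribute. Deleting one copy from each
  leaves the partitions of \<open>m - k\<close>; the cardinality accounts for the deleted
  copies.\<close>

lemma part_occurrences_rec:
  assumes "1 \<le> r" "r \<le> k"
  shows "part_occurrences r m k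
    = (if k \<le> m then card (partitions_ge r (m - k)) + part_occurrences r (m - k) k else 0)"
proof (cases "k \<le> m")
  case True
  have "part_occurrences r m k = (\<Sum>M | M \<in> partitions_ge r m \<and> k \<in># M. count M k)"
    unfolding part_occurrences_eq_sum
    by (intro sum.mono_neutral_right) (auto simp: not_in_iff)
  also have "\<dots> = (\<Sum>M\<in>partitions_ge r (m - k). count (add_mset k M) k)"
    using sum.reindex_bij_betw[OF bij_betw_add_part[OF assms, of "m - k"], of "\<lambda>M. count M k"] True
    by simp
  also have "\<dots> = card (partitions_ge r (m - k)) + part_occurrences r (m - k) k"
    by (simp add: part_occurrences_eq_sum sum_Suc)
  finally show ?thesis using True by simp
next
  case False
  then show ?thesis
    using no_part_if_small[of _ r m k] by (auto simp: part_occurrences_eq_sum not_in_iff)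
qed

section \<open>Partitions with a unique largest part\<close>

lemma Max_mset_add_mset:
  fixes a :: "'a :: linorder"
  assumes "\<forall>x\<in>#N. x \<le> a"
  shows "Max (set_mset (add_mset a N)) = a"
  using assms by (intro Max_eqI) auto

lemma mset_split_Max:
  fixes M :: "'a :: linorder multiset"
  assumes "M \<noteq> {#}"
  obtains a N where "M = add_mset a N" "\<forall>x\<in>#N. x \<le> a"
proof
  let ?a = "Max (set_mset M)"
  show "M = add_mset ?a (M - {#?a#})"
    using assms by simp
  show "\<forall>x\<in>#M - {#?a#}. x \<le> ?a"
    by (auto dest: in_diffD)
qed

lemma card_unique_largest_part:
  assumes "1 \<le> r" "r < n"
  shows "card {M \<in> partitions_ge r n. count M (Max (set_mset M)) = 1}
    = card (partitions_ge r (n - 1))"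
proof -
  define inc :: "nat multiset \<Rightarrow> nat multiset"
    where "inc M = add_mset (Suc (Max (set_mset M))) (M - {#Max (set_mset M)#})" for M
  define dec :: "nat multiset \<Rightarrow> nat multiset"
    where "dec M = add_mset (Max (set_mset M) - 1) (M - {#Max (set_mset M)#})" for M
  have inc: "inc (add_mset a N) = add_mset (Suc a) N" if "\<forall>x\<in>#N. x \<le> a" for a N
    using that by (simp add: inc_def Max_mset_add_mset del: set_mset_add_mset_insert)
  have dec: "dec (add_mset a N) = add_mset (a - 1) N" if "\<forall>x\<in>#N. x \<le> a" for a N
    using that by (simp add: dec_def Max_mset_add_mset del: set_mset_add_mset_insert)
  let ?U = "{M \<in> partitions_ge r n. count M (Max (set_mset M)) = 1}"
  have 1: "inc M \<in> ?U \<and> dec (inc M) = M" if M: "M \<in> partitions_ge r (n - 1)" for M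
  proof -
    have "M \<noteq> {#}"
      using M assms by (auto simp: partitions_ge_iff)
    then obtain a N where N: "M = add_mset a N" "\<forall>x\<in>#N. x \<le> a"
      by (rule mset_split_Max)
    then have le: "\<forall>x\<in>#N. x \<le> Suc a" by auto
    have "Suc a \<notin># N" using N by auto
    then have "count (add_mset (Suc a) N) (Suc a) = 1"
      by (simp add: not_in_iff)
    then show ?thesis
      using M assms N le
      by (auto simp: partitions_ge_iff inc dec Max_mset_add_mset simp del: set_mset_add_mset_insert)
         (auto simp: partitions_ge_iff)
  qed
  have 2: "dec M \<in> partitions_ge r (n - 1) \<and> inc (dec M) = M" if M: "M \<in> ?U" for M
  proof -
    have "M \<noteq> {#}"
      using M assms by (auto simp: partitions_ge_iff)
    then obtain a N where N: "M = add_mset a N" "\<forall>x\<in>#N. x \<le> a"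
      by (rule mset_split_Max)
    then have "count N a = 0"
      using M Max_mset_add_mset[of N a] by simp
    then have less: "\<forall>x\<in>#N. x < a"
      using N by (metis not_in_iff order_le_less)
    then have le: "\<forall>x\<in>#N. x \<le> a - 1" by auto
    have sum: "a + sum_mset N = n" and ge: "\<forall>x\<in>#N. r \<le> x" "r \<le> a"
      using M N assms by (auto simp: partitions_ge_iff)
    \<comment> \<open>This strict bound keeps the decreased part \<open>a - 1\<close> at least
      \<open>r\<close>. If \<open>a\<close> is the only part, it equals \<open>n > r\<close>;
      otherwise it exceeds another part.\<close>
    have "r < a"
    proof (cases "N = {#}")
      case True
      then show ?thesis using sum assms by simp
    next
      case False
      then obtain x where "x \<in># N" by auto
      then show ?thesis using ge less by (auto intro: le_less_trans)
    qed
    then show ?thesis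
      using N le sum ge assms by (auto simp: partitions_ge_iff inc dec)
  qed
  have "bij_betw inc (partitions_ge r (n - 1)) ?U"
    using 1 2 by (intro bij_betw_byWitness[where f' = dec]) blast+
  then show ?thesis
    by (simp add: bij_betw_same_card)
qed

section \<open>The Moebius function\<close>

lemma moebius_1: "moebius 1 = 1"
  by (auto simp: moebius_def)

text \<open>The new prime \<open>p\<close> adds one prime factor and creates no square divisor:
  \<open>p\<close> itself divides \<open>p * d\<close> only once, and the square of any other prime
  is coprime to \<open>p\<close>.\<close>

lemma moebius_prime_times:
  assumes "prime p" "\<not> p dvd d"
  shows "moebius (p * d) = - moebius d"
proof -
  have "d \<noteq> 0" using assms(2) by (cases "d = 0") auto
  have sq: "q\<^sup>2 dvd p * d \<longleftrightarrow> q\<^sup>2 dvd d" if "prime q" for q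
  proof (cases "q = p")
    case True
    then show ?thesis
      using assms by (auto simp: power2_eq_square prime_gt_0_nat dest: dvd_mult_left)
  next
    case False
    then have "coprime (q\<^sup>2) p"
      using that assms(1) by (simp add: primes_coprime)
    then show ?thesis by (simp add: coprime_dvd_mult_right_iff)
  qed
  have "prime_factors (p * d) = insert p (prime_factors d)"
    using assms \<open>d \<noteq> 0\<close>
    by (auto simp: prime_factors_product prime_prime_factors)
  moreover have "p \<notin> prime_factors d"
    using assms by (auto simp: in_prime_factors_iff)
  ultimately have "card (prime_factors (p * d)) = Suc (card (prime_factors d))"
    by simp
  then show ?thesis
    using sq by (auto simp: moebius_def)
qed

lemma moebius_prime: "prime p \<Longrightarrow> moebius p = -1"
  using moebius_prime_times[of p 1] moebius_1 by (simp add: prime_nat_iff)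

text \<open>For \<open>N > 1\<close> fix a prime \<open>p\<close> dividing \<open>N\<close>.
  Divisors \<open>d\<close> prime to \<open>p\<close> cancel against \<open>p * d\<close>, and
  multiples of the square of \<open>p\<close> contribute nothing.\<close>

lemma sum_moebius_divisors:
  assumes "N > 0"
  shows "(\<Sum>d | d dvd N. moebius d) = (if N = 1 then 1 else 0)"
proof (cases "N = 1")
  case True
  then show ?thesis using moebius_1 by simp
next
  case False
  then obtain p where p: "prime p" "p dvd N"
    using prime_factor_nat by blast
  have fin: "finite {d. d dvd N}"
    using assms by simp
  let ?A = "{d. d dvd N \<and> \<not> p dvd d}" and ?B = "{d. d dvd N \<and> p dvd d \<and> \<not> p\<^sup>2 dvd d}"
  have "(\<Sum>d | d dvd N. moebius d) = (\<Sum>d\<in>?A \<union> ?B. moebius d)"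
    using fin p by (intro sum.mono_neutral_right) (auto simp: moebius_def)
  also have "\<dots> = (\<Sum>d\<in>?A. moebius d) + (\<Sum>d\<in>?B. moebius d)"
    using fin by (intro sum.union_disjoint) auto
  also have "(\<Sum>d\<in>?B. moebius d) = (\<Sum>d\<in>?A. moebius (p * d))"
  proof (rule sum.reindex_bij_betw[symmetric])
    show "bij_betw ((*) p) ?A ?B"
      unfolding bij_betw_def
    proof
      show "inj_on ((*) p) ?A"
        using p by (auto simp: inj_on_def)
      \<comment> \<open>Since \<open>p\<close> and \<open>d\<close> are coprime divisors of
        \<open>N\<close>, their product divides \<open>N\<close> too.\<close>
      have "p * d \<in> ?B" if "d \<in> ?A" for d
        using that p by (auto simp: power2_eq_square prime_imp_coprime intro!: divides_mult)
      moreover have "d \<in> (*) p ` ?A" if "d \<in> ?B" for d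
        using that by (auto simp: power2_eq_square elim!: dvdE[of p d] intro: dvd_mult_right)
      ultimately show "(*) p ` ?A = ?B" by blast
    qed
  qed
  also have "\<dots> = - (\<Sum>d\<in>?A. moebius d)"
    using p by (simp add: moebius_prime_times flip: sum_negf)
  finally show ?thesis using False by simp
qed

text \<open>All divisors of \<open>N\<close> are at most \<open>m\<close>, so this is the full
  divisor sum minus the terms for 1, 2, 3, whose Moebius values are 1, -1, -1.\<close>

lemma sum_moebius_tail:
  assumes "N > 0" "N \<le> m" "3 \<le> m"
  shows "(\<Sum>k=4..m. if k dvd N then moebius k else 0)
    = (if N = 1 then 1 else 0) - 1 + (if 2 dvd N then 1 else 0) + (if 3 dvd N then 1 else 0)"
proof -
  let ?f = "\<lambda>k. if k dvd N then moebius k else 0"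
  have "k \<in> {1..m}" if "k dvd N" for k
    using that assms by (auto dest: dvd_imp_le intro!: Suc_leI gr0I)
  then have "(\<Sum>d | d dvd N. moebius d) = (\<Sum>k=1..m. ?f k)"
    by (intro sum.mono_neutral_cong_left) auto
  also have "{1..m} = {1, 2, 3} \<union> {4..m}"
    using assms(3) by auto
  also have "sum ?f \<dots> = ?f 1 + ?f 2 + ?f 3 + (\<Sum>k=4..m. ?f k)"
    by (subst sum.union_disjoint) auto
  finally show ?thesis
    using sum_moebius_divisors[OF assms(1)]
    by (simp add: moebius_1[unfolded One_nat_def] moebius_prime split: if_splits)
qed

section \<open>Generating functions\<close>

definition partitions_ge_fps :: "nat \<Rightarrow> int fps" where
  "partitions_ge_fps r = Abs_fps (\<lambda>m. int (card (partitions_ge r m)))"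

lemma partitions_ge_fps_1_nth: "partitions_ge_fps 1 $ m = int (num_partitions m)"
  by (simp only: partitions_ge_fps_def fps_nth_Abs_fps partitions_ge_1 num_partitions_def)

text \<open>The series \<open>D k\<close> of the overview, written by coefficients so that no
  division of power series is involved.\<close>

definition multiples_fps :: "nat \<Rightarrow> int fps" where
  "multiples_fps k = Abs_fps (\<lambda>m. if m > 0 \<and> k dvd m then 1 else 0)"

lemma partitions_ge_fps_Suc:
  assumes "1 \<le> r"
  shows "partitions_ge_fps (Suc r) = (1 - fps_X ^ r) * partitions_ge_fps r"
  by (rule fps_ext)
     (use card_partitions_ge_split[OF assms] in
       \<open>auto simp: partitions_ge_fps_def algebra_simps fps_X_power_mult_nth\<close>)

lemma one_minus_X_power_mult_multiples_fps:
  assumes "1 \<le> k"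
  shows "(1 - fps_X ^ k) * multiples_fps k = fps_X ^ k"
proof (rule fps_ext)
  fix m
  have "k dvd m \<longleftrightarrow> k dvd m - k" if "k \<le> m"
    using that by (simp add: dvd_minus_self)
  moreover have "\<not> k dvd m" if "0 < m" "m < k"
    using that by (auto dest: dvd_imp_le)
  ultimately show "((1 - fps_X ^ k) * multiples_fps k) $ m = (fps_X ^ k :: int fps) $ m"
    using assms
    by (cases "m < k"; cases "m = k")
       (auto simp: multiples_fps_def algebra_simps fps_X_power_mult_nth fps_X_power_nth)
qed

lemma one_minus_X_power_nonzero:
  assumes "1 \<le> k"
  shows "1 - fps_X ^ k \<noteq> (0 :: int fps)"
proof
  assume "1 - fps_X ^ k = (0 :: int fps)"
  then have "(1 - fps_X ^ k) $ 0 = (0 :: int fps) $ 0" by simp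
  then show False using assms by (simp add: fps_X_power_nth)
qed

text \<open>The recurrence says that the series \<open>O\<close> of occurrences satisfies
  \<open>O = X ^ k * (P r + O)\<close>; solve for \<open>O\<close> by cancelling the nonzero factor
  \<open>1 - X ^ k\<close>.\<close>

lemma part_occurrences_fps:
  assumes "1 \<le> r" "r \<le> k"
  shows "Abs_fps (\<lambda>m. int (part_occurrences r m k)) = partitions_ge_fps r * multiples_fps k"
    (is "?O = _")
proof -
  have k: "1 \<le> k" using assms by simp
  have "?O = fps_X ^ k * (partitions_ge_fps r + ?O)"
    by (rule fps_ext, subst fps_nth_Abs_fps, subst part_occurrences_rec[OF assms])
       (auto simp: partitions_ge_fps_def fps_X_power_mult_nth)
  then have "(1 - fps_X ^ k) * ?O = fps_X ^ k * partitions_ge_fps r"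
    by (simp add: algebra_simps)
  also have "\<dots> = (1 - fps_X ^ k) * (partitions_ge_fps r * multiples_fps k)"
    by (subst one_minus_X_power_mult_multiples_fps[OF k, symmetric]) (simp only: mult_ac)
  finally show ?thesis
    using one_minus_X_power_nonzero[OF k] by simp
qed

text \<open>The coefficient at \<open>m\<close> of a product involves only coefficients up to
  \<open>m\<close>, and there the sum over \<open>k \<le> m\<close> agrees with the infinite series.
  No convergence argument is required.\<close>

lemma sum_part_occurrences_moebius:
  assumes "3 \<le> m"
  shows "(\<Sum>k=4..m. int (part_occurrences 4 m k) * moebius k)
    = (partitions_ge_fps 4
        * (fps_X - multiples_fps 1 + multiples_fps 2 + multiples_fps 3)) $ m"
proof -
  let ?C = "fps_X - multiples_fps 1 + multiples_fps 2 + multiples_fps 3"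
  have C: "(\<Sum>k=4..m. moebius k * multiples_fps k $ i) = ?C $ i" if "i \<le> m" for i
  proof (cases "i = 0")
    case False
    then have "(\<Sum>k=4..m. moebius k * multiples_fps k $ i)
        = (\<Sum>k=4..m. if k dvd i then moebius k else 0)"
      by (intro sum.cong) (auto simp: multiples_fps_def)
    then show ?thesis
      using sum_moebius_tail[of i m] that assms False
      by (simp add: multiples_fps_def fps_X_nth)
  qed (simp add: multiples_fps_def)
  have "(\<Sum>k=4..m. int (part_occurrences 4 m k) * moebius k)
      = (\<Sum>k=4..m. (partitions_ge_fps 4 * multiples_fps k) $ m * moebius k)"
    by (intro sum.cong refl) (simp flip: part_occurrences_fps)
  also have "\<dots> = (\<Sum>k=4..m. \<Sum>i=0..m.
      partitions_ge_fps 4 $ (m - i) * (moebius k * multiples_fps k $ i))"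
    \<comment> \<open>Commuting first gives \<open>multiples_fps k\<close> the convolution index
      \<open>i\<close>, so that the inner sum over \<open>k\<close> matches
      \<open>C\<close>.\<close>
    by (subst mult.commute[of "partitions_ge_fps 4"])
       (simp add: fps_mult_nth sum_distrib_left mult_ac)
  also have "\<dots> = (\<Sum>i=0..m. partitions_ge_fps 4 $ (m - i) *
      (\<Sum>k=4..m. moebius k * multiples_fps k $ i))"
    by (subst sum.swap) (simp add: sum_distrib_left)
  also have "\<dots> = (\<Sum>i=0..m. partitions_ge_fps 4 $ (m - i) * ?C $ i)"
    by (intro sum.cong refl) (simp only: C atLeastAtMost_iff)
  also have "\<dots> = (?C * partitions_ge_fps 4) $ m"
    unfolding fps_mult_nth[of ?C] by (intro sum.cong refl mult.commute)
  finally show ?thesis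
    by (simp only: mult.commute)
qed

lemma partitions_ge_4_mult_tail:
  "partitions_ge_fps 4 * (fps_X - multiples_fps 1 + multiples_fps 2 + multiples_fps 3)
    = - (fps_X ^ 5 * ((1 - fps_X)\<^sup>2 * partitions_ge_fps 1))"
proof -
  let ?P = "partitions_ge_fps 1" and ?X = "fps_X :: int fps"
  have P4: "partitions_ge_fps 4 = (1 - fps_X) * (1 - fps_X ^ 2) * (1 - fps_X ^ 3) * ?P"
    using partitions_ge_fps_Suc[of 1] partitions_ge_fps_Suc[of 2] partitions_ge_fps_Suc[of 3]
    by (simp add: mult_ac eval_nat_numeral)
  have D: "(1 - fps_X) * multiples_fps 1 = fps_X"
    "(1 - fps_X ^ 2) * multiples_fps 2 = fps_X ^ 2"
    "(1 - fps_X ^ 3) * multiples_fps 3 = fps_X ^ 3"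
    using one_minus_X_power_mult_multiples_fps[of 1]
      one_minus_X_power_mult_multiples_fps[of 2] one_minus_X_power_mult_multiples_fps[of 3]
    by simp_all
  \<comment> \<open>Each factor \<open>1 - X ^ k\<close> of \<open>P 4\<close> is paired with
    \<open>D k\<close> to clear its denominator; what remains is a polynomial identity.\<close>
  have "partitions_ge_fps 4 * (fps_X - multiples_fps 1 + multiples_fps 2 + multiples_fps 3)
      = ?P * ((1 - ?X) * (1 - ?X ^ 2) * (1 - ?X ^ 3) * ?X
          - (1 - ?X ^ 2) * (1 - ?X ^ 3) * ((1 - ?X) * multiples_fps 1)
          + (1 - ?X) * (1 - ?X ^ 3) * ((1 - ?X ^ 2) * multiples_fps 2)
          + (1 - ?X) * (1 - ?X ^ 2) * ((1 - ?X ^ 3) * multiples_fps 3))"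
    unfolding P4 by (simp add: algebra_simps)
  also have "\<dots> = - (?X ^ 5 * ((1 - ?X)\<^sup>2 * ?P))"
    unfolding D by (simp add: algebra_simps eval_nat_numeral)
  finally show ?thesis .
qed

lemma one_minus_X_squared_mult_nth:
  fixes F :: "int fps"
  assumes "2 \<le> n"
  shows "((1 - fps_X)\<^sup>2 * F) $ n = F $ n - 2 * F $ (n - 1) + F $ (n - 2)"
proof -
  have "(1 - fps_X)\<^sup>2 * F = F - fps_const 2 * (fps_X * F) + fps_X ^ 2 * F"
    by (simp add: power2_eq_square algebra_simps numeral_fps_const[symmetric])
  then show ?thesis
    using assms by (simp add: fps_X_power_mult_nth)
qed

theorem corollary1p6:
  fixes n :: nat
  assumes "n \<ge> 3"
  shows "int (card {M \<in> partitions n. 1 \<notin># M \<and> count M (Max (set_mset M)) > 1})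
           = backward_diff 2 (\<lambda>m. int (num_partitions m)) n
       \<and> backward_diff 2 (\<lambda>m. int (num_partitions m)) n
           = int (num_partitions n) - 2 * int (num_partitions (n - 1)) + int (num_partitions (n - 2))
       \<and> backward_diff 2 (\<lambda>m. int (num_partitions m)) n
           = - (\<Sum>k=4..n + 5. int (part_occurrences 4 (n + 5) k) * moebius k)"
proof -
  have diff: "backward_diff 2 (\<lambda>m. int (num_partitions m)) n
      = int (num_partitions n) - 2 * int (num_partitions (n - 1)) + int (num_partitions (n - 2))"
    by (simp add: backward_diff_def eval_nat_numeral)
  have P2: "int (card (partitions_ge 2 m)) = int (num_partitions m) - int (num_partitions (m - 1))"
    if "1 \<le> m" for m
    using card_partitions_ge_split[of 1 m] that
    by (simp add: partitions_ge_1[unfolded One_nat_def] num_partitions_def eval_nat_numeral)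
  let ?U = "{M \<in> partitions_ge 2 n. count M (Max (set_mset M)) = 1}"
  let ?V = "{M \<in> partitions n. 1 \<notin># M \<and> count M (Max (set_mset M)) > 1}"
  have eq: "M \<in> partitions_ge 2 n \<longleftrightarrow> M \<in> partitions n \<and> 1 \<notin># M" for M
    using partitions_ge_without[of 1 n] partitions_ge_1[of n] by (auto simp: eval_nat_numeral)
  \<comment> \<open>As \<open>n > 0\<close>, the partition is nonempty and its maximum is a genuine
    part.\<close>
  have "count M (Max (set_mset M)) = 1 \<or> count M (Max (set_mset M)) > 1"
    if "M \<in> partitions_ge 2 n" for M
  proof -
    have "M \<noteq> {#}" using that assms by (auto simp: partitions_ge_iff)
    then have "count M (Max (set_mset M)) > 0" by simp
    then show ?thesis by linarith
  qed
  then have "partitions_ge 2 n = ?U \<union> ?V"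
    using eq by blast
  moreover have "card (?U \<union> ?V) = card ?U + card ?V"
    by (rule card_Un_disjoint) (auto simp: finite_partitions)
  ultimately have "card (partitions_ge 2 n) = card ?U + card ?V"
    by (rule ssubst)
  \<comment> \<open>The partitions in \<open>?U\<close> are as many as those of \<open>n - 1\<close>
    without ones, which uses \<open>2 < n\<close>. Two applications of \<open>P2\<close> then give a
    difference of first differences.\<close>
  then have "int (card ?V) = int (num_partitions n) - 2 * int (num_partitions (n - 1))
      + int (num_partitions (n - 2))"
    using card_unique_largest_part[of 2 n] P2[of n] P2[of "n - 1"] assms
    by (simp add: numeral_2_eq_2)
  \<comment> \<open>The factor \<open>X ^ 5\<close> shifts the coefficient at \<open>n + 5\<close>
    to the one at \<open>n\<close>.\<close>
  moreover have "(\<Sum>k=4..n + 5. int (part_occurrences 4 (n + 5) k) * moebius k)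
      = - (int (num_partitions n) - 2 * int (num_partitions (n - 1)) + int (num_partitions (n - 2)))"
    using assms
    by (simp add: sum_part_occurrences_moebius partitions_ge_4_mult_tail fps_X_power_mult_nth
        one_minus_X_squared_mult_nth partitions_ge_fps_1_nth del: One_nat_def)
  ultimately show ?thesis
    using diff by simp
qed

end
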